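(* The homomorphism densities $t(H,-)$, $H\in\mathcal H$, are linearly independent as functions on $\mathcal W_{\bf p}=\bigcup_{p=1}^\infty\mathcal W_p$, and hence on $\mathcal W$. In particular, the $t(H,-)$ for $H\in\mathcal G$ are also linearly independent.
   Context: $\mathcal W$ is the vector space of bounded symmetric measurable functions $f:[0,1]^2\to\mathbb R$; $\mathcal W_{[0,1]}$ is the subset of those with values in $[0,1]$. For $1\le a<b\le p$, $e^p_{(a,b)}$ is the indicator function of $\left(\frac{a-1}p,\frac ap\right]\times\left(\frac{b-1}p,\frac bp\right]$ plus that of $\left(\frac{b-1}p,\frac bp\right]\times\left(\frac{a-1}p,\frac ap\right]$; $\mathcal W_p=\mathcal W_{[0,1]}\cap\operatorname{span}_{\mathbb R}\{e^p_{(a,b)}:1\le a<b\le p\}$. Multigraphs are finite, undirected, without loops, possibly with multiple edges; an edge $e$ has endpoints $\{e_s,e_t\}$. $\mathcal H$ (resp. $\mathcal G$) is the set of isomorphism classes of multigraphs (resp. simple graphs) with no isolated vertices. $t(H,f)=\int_{[0,1]^{V(H)}}\prod_{e\in E(H)}f(x_{e_s},x_{e_t})\prod_idx_i$, with $t(H,f)\equiv1$ if $H$ has no edges. *)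

theory Defs
  imports "HOL-Probability.Probability" "HOL-Library.Multiset"
begin

section \<open>The spaces of symmetric functions on the unit square\<close>

text \<open>A function on \<open>[0,1]\<^sup>2\<close> is represented by its extension by zero to the whole plane,
  so that equality of representatives is equality of functions on the square.\<close>

definition unit_square :: "(real \<times> real) set" where
  "unit_square = {0..1} \<times> {0..1}"

definition \<W> :: "(real \<times> real \<Rightarrow> real) set" where
  "\<W> = {f. (\<forall>z. z \<notin> unit_square \<longrightarrow> f z = 0)
        \<and> f \<in> borel_measurable (lebesgue_on unit_square)
        \<and> bounded (f ` unit_square)
        \<and> (\<forall>x y. f (x, y) = f (y, x))}"

definition \<W>_unit :: "(real \<times> real \<Rightarrow> real) set" where
  "\<W>_unit = {f \<in> \<W>. \<forall>z \<in> unit_square. 0 \<le> f z \<and> f z \<le> 1}"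

definition cell :: "nat \<Rightarrow> nat \<Rightarrow> nat \<Rightarrow> (real \<times> real) set" where
  "cell p a b = {(real a - 1) / real p <.. real a / real p} \<times> {(real b - 1) / real p <.. real b / real p}"

definition block :: "nat \<Rightarrow> nat \<Rightarrow> nat \<Rightarrow> real \<times> real \<Rightarrow> real" where
  "block p a b z = indicator (cell p a b) z + indicator (cell p b a) z"

definition block_pairs :: "nat \<Rightarrow> (nat \<times> nat) set" where
  "block_pairs p = {(a, b). 1 \<le> a \<and> a < b \<and> b \<le> p}"

definition block_span :: "nat \<Rightarrow> (real \<times> real \<Rightarrow> real) set" where
  "block_span p = {f. \<exists>c. \<forall>z. f z = (\<Sum>(a, b) \<in> block_pairs p. c a b * block p a b z)}"

definition \<W>_step :: "nat \<Rightarrow> (real \<times> real \<Rightarrow> real) set" where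
  "\<W>_step p = \<W>_unit \<inter> block_span p"

definition \<W>_steps :: "(real \<times> real \<Rightarrow> real) set" where
  "\<W>_steps = (\<Union>p \<in> {1..}. \<W>_step p)"


section \<open>Multigraphs\<close>

text \<open>As only isomorphism classes of finite graphs matter, the vertices are natural numbers.
  The graph without vertices has no isolated vertices; its class is the only one in \<open>\<H>\<close>
  without edges, and its density is the constant \<open>1\<close>. An edge is given by its two-element set of endpoints, its multiplicity being the number of
  parallel edges.\<close>

record multigraph =
  verts :: "nat set"
  edges :: "nat set multiset"

definition multigraph :: "multigraph \<Rightarrow> bool" where
  "multigraph H \<longleftrightarrow> finite (verts H) \<and> (\<forall>e \<in># edges H. e \<subseteq> verts H \<and> card e = 2)"

definition simple_graph :: "multigraph \<Rightarrow> bool" where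
  "simple_graph H \<longleftrightarrow> multigraph H \<and> (\<forall>e. count (edges H) e \<le> 1)"

definition no_isolated_verts :: "multigraph \<Rightarrow> bool" where
  "no_isolated_verts H \<longleftrightarrow> (\<forall>v \<in> verts H. \<exists>e \<in># edges H. v \<in> e)"

definition isomorphic :: "multigraph \<Rightarrow> multigraph \<Rightarrow> bool" where
  "isomorphic G H \<longleftrightarrow>
    (\<exists>\<pi>. bij_betw \<pi> (verts G) (verts H) \<and> edges H = image_mset (\<lambda>e. \<pi> ` e) (edges G))"

definition iso_rel :: "(multigraph \<times> multigraph) set" where
  "iso_rel = {(G, H). multigraph G \<and> multigraph H \<and> isomorphic G H}"

definition \<H> :: "multigraph set set" where
  "\<H> = {H. multigraph H \<and> no_isolated_verts H} // iso_rel"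

definition \<G> :: "multigraph set set" where
  "\<G> = {H. simple_graph H \<and> no_isolated_verts H} // iso_rel"


section \<open>Homomorphism densities\<close>

text \<open>The completion makes the integrand measurable for every Lebesgue measurable \<open>f\<close>, not only
  for the Borel measurable ones. Since \<open>f\<close> is symmetric, it does not matter which endpoint of
  \<open>e\<close> comes first; the smaller one is taken.\<close>

definition hom_density :: "multigraph \<Rightarrow> (real \<times> real \<Rightarrow> real) \<Rightarrow> real" where
  "hom_density H f =
    (LINT x | completion (\<Pi>\<^sub>M v \<in> verts H. restrict_space lborel {0..1}).
       (\<Prod>e \<in># edges H. f (x (Min e), x (Max e))))"

text \<open>The density of an isomorphism class is that of any representative; see
  \<open>iso_density_eq\<close> below.\<close>

definition iso_density :: "multigraph set \<Rightarrow> (real \<times> real \<Rightarrow> real) \<Rightarrow> real" where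
  "iso_density C = hom_density (SOME H. H \<in> C)"

definition linearly_independent_on :: "'i set \<Rightarrow> ('i \<Rightarrow> 'a \<Rightarrow> real) \<Rightarrow> 'a set \<Rightarrow> bool" where
  "linearly_independent_on I \<phi> X \<longleftrightarrow>
    (\<forall>F c. finite F \<and> F \<subseteq> I \<and> (\<forall>x \<in> X. (\<Sum>i \<in> F. c i * \<phi> i x) = 0) \<longrightarrow> (\<forall>i \<in> F. c i = 0))"


section \<open>Well-definedness on isomorphism classes\<close>

lemma isomorphic_sym:
  assumes "multigraph G" and "isomorphic G H"
  shows "isomorphic H G"
proof -
  obtain \<pi> where \<pi>: "bij_betw \<pi> (verts G) (verts H)"
      and E: "edges H = image_mset (\<lambda>e. \<pi> ` e) (edges G)"
    using assms(2) by (auto simp: isomorphic_def)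
  let ?\<rho> = "inv_into (verts G) \<pi>"
  have "?\<rho> ` \<pi> ` e = e" if "e \<in># edges G" for e
    using that assms(1) \<pi> inv_into_image_cancel[of \<pi> "verts G" e]
    by (auto simp: multigraph_def bij_betw_def)
  then have "image_mset (\<lambda>e. ?\<rho> ` \<pi> ` e) (edges G) = image_mset (\<lambda>e. e) (edges G)"
    by (intro image_mset_cong)
  then have "edges G = image_mset (\<lambda>e. ?\<rho> ` e) (edges H)"
    by (simp add: E multiset.map_comp comp_def)
  then show ?thesis
    using bij_betw_inv_into[OF \<pi>] by (auto simp: isomorphic_def)
qed

lemma isomorphic_trans:
  assumes "isomorphic G H" and "isomorphic H K"
  shows "isomorphic G K"
proof -
  obtain \<pi> \<rho> where "bij_betw \<pi> (verts G) (verts H)" "bij_betw \<rho> (verts H) (verts K)"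
      and "edges H = image_mset (\<lambda>e. \<pi> ` e) (edges G)"
          "edges K = image_mset (\<lambda>e. \<rho> ` e) (edges H)"
    using assms by (auto simp: isomorphic_def)
  moreover from this have "bij_betw (\<rho> \<circ> \<pi>) (verts G) (verts K)"
    by (blast intro: bij_betw_trans)
  ultimately have "bij_betw (\<rho> \<circ> \<pi>) (verts G) (verts K)"
      and "edges K = image_mset (\<lambda>e. (\<rho> \<circ> \<pi>) ` e) (edges G)"
    by (simp_all add: multiset.map_comp comp_def image_image)
  then show ?thesis
    unfolding isomorphic_def by blast
qed

lemma equiv_iso_rel: "equiv {H. multigraph H} iso_rel"
proof (rule equivI)
  have "isomorphic H H" for H
    unfolding isomorphic_def by (rule exI[of _ id]) auto
  then show "refl_on {H. multigraph H} iso_rel"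
    by (auto simp: refl_on_def iso_rel_def)
  show "sym iso_rel"
    by (auto simp: sym_def iso_rel_def intro: isomorphic_sym)
  show "trans iso_rel"
    by (auto simp: trans_def iso_rel_def intro: isomorphic_trans)
qed (auto simp: iso_rel_def)

lemma completion_PiM_reindex:
  fixes M :: "'b measure"
  assumes M: "prob_space M" and \<pi>: "bij_betw \<pi> I K"
  defines "T \<equiv> \<lambda>x. \<lambda>i\<in>I. x (\<pi> i)"
  shows "T \<in> completion (\<Pi>\<^sub>M k\<in>K. M) \<rightarrow>\<^sub>M completion (\<Pi>\<^sub>M i\<in>I. M)"
    and "distr (completion (\<Pi>\<^sub>M k\<in>K. M)) (completion (\<Pi>\<^sub>M i\<in>I. M)) T = completion (\<Pi>\<^sub>M i\<in>I. M)"
proof -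
  let ?K = "\<Pi>\<^sub>M k\<in>K. M" and ?I = "\<Pi>\<^sub>M i\<in>I. M"
  have fact: "distr ?K ?I T = ?I"
    unfolding T_def using distr_PiM_reindex[of K "\<lambda>_. M" \<pi> I] M \<pi> by (auto simp: bij_betw_def)
  have T0: "T \<in> ?K \<rightarrow>\<^sub>M ?I"
    unfolding T_def using \<pi> by (intro measurable_restrict measurable_component_singleton)
      (auto simp: bij_betw_def)
  then have T: "T \<in> completion ?K \<rightarrow>\<^sub>M ?I"
    by (rule measurable_completion)
  have d: "distr (completion ?K) ?I T = ?I"
    using distr_completion[OF T0] fact by simp
  have null: "null_sets (distr (completion ?K) ?I T) = null_sets ?I"
    by (simp add: d)
  show "T \<in> completion ?K \<rightarrow>\<^sub>M completion ?I"
    using completion.measurable_completion2[OF T] null by simp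
  show "distr (completion ?K) (completion ?I) T = completion ?I"
    using completion.completion_distr_eq[OF T null] by (simp add: d)
qed

lemma hom_density_isomorphic:
  assumes G: "multigraph G" and iso: "isomorphic G H"
    and sym: "\<And>x y. f (x, y) = f (y, x)"
  shows "hom_density G f = hom_density H f"
proof -
  obtain \<pi> where \<pi>: "bij_betw \<pi> (verts G) (verts H)"
      and E: "edges H = image_mset (\<lambda>e. \<pi> ` e) (edges G)"
    using iso by (auto simp: isomorphic_def)
  let ?U = "restrict_space lborel {0..1::real}"
  let ?M = "\<lambda>H. completion (\<Pi>\<^sub>M v \<in> verts H. ?U)"
  let ?g = "\<lambda>H x. \<Prod>e \<in># edges H. f (x (Min e), x (Max e))"
  let ?T = "\<lambda>x. \<lambda>v\<in>verts G. x (\<pi> v)"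
  let ?\<rho> = "inv_into (verts G) \<pi>"
  let ?S = "\<lambda>x. \<lambda>v\<in>verts H. x (?\<rho> v)"
  have U: "prob_space ?U"
    by (rule prob_spaceI) (simp add: space_restrict_space emeasure_restrict_space)
  note T = completion_PiM_reindex[OF U \<pi>]
  note S = completion_PiM_reindex(1)[OF U bij_betw_inv_into[OF \<pi>]]
  have gT: "?g G (?T x) = ?g H x" for x
  proof -
    have "f (?T x (Min e), ?T x (Max e)) = f (x (Min (\<pi> ` e)), x (Max (\<pi> ` e)))"
      if e: "e \<in># edges G" for e
    proof -
      obtain u v where uv: "e = {u, v}" "u < v"
        using G e by (auto simp: multigraph_def card_2_iff) (metis insert_commute linorder_neqE_nat)
      moreover have "u \<in> verts G" "v \<in> verts G"
        using G e uv by (auto simp: multigraph_def)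
      ultimately show ?thesis
        using sym by (cases "\<pi> u \<le> \<pi> v") (auto simp: max_def min_def)
    qed
    then show ?thesis
      by (auto simp: E multiset.map_comp comp_def intro!: arg_cong[of _ _ prod_mset] image_mset_cong)
  qed
  have TS: "?T (?S x) = x" if "x \<in> space (?M G)" for x
    using that \<pi>
    by (fastforce simp: space_PiM PiE_def extensional_def bij_betw_def inv_into_f_f)
  show ?thesis
  proof (cases "?g G \<in> borel_measurable (?M G)")
    case True
    have "hom_density G f = integral\<^sup>L (distr (?M H) (?M G) ?T) (?g G)"
      by (simp add: hom_density_def T(2))
    also have "\<dots> = integral\<^sup>L (?M H) (\<lambda>x. ?g G (?T x))"
      by (rule integral_distr[OF T(1) True])
    finally show ?thesis
      by (simp only: gT hom_density_def)
  next
    case False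
    have "?g H \<notin> borel_measurable (?M H)"
    proof
      assume "?g H \<in> borel_measurable (?M H)"
      from measurable_compose[OF S this] have "(\<lambda>x. ?g G (?T (?S x))) \<in> borel_measurable (?M G)"
        by (simp only: gT)
      moreover have "?g G (?T (?S x)) = ?g G x" if "x \<in> space (?M G)" for x
        by (simp only: TS[OF that])
      ultimately have "?g G \<in> borel_measurable (?M G)"
        by (subst measurable_cong[where g = "\<lambda>x. ?g G (?T (?S x))"]) simp_all
      with False show False by contradiction
    qed
    with False have ni: "\<not> integrable (?M G) (?g G)" "\<not> integrable (?M H) (?g H)"
      using borel_measurable_integrable by blast+
    show ?thesis
      by (simp only: hom_density_def ni[THEN not_integrable_integral_eq])
  qed
qed

lemma iso_density_eq:
  assumes "C \<in> \<H>" and "H \<in> C" and "f \<in> \<W>"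
  shows "iso_density C f = hom_density H f"
proof -
  have C: "C \<in> {H. multigraph H} // iso_rel"
    using assms(1) by (auto simp: \<H>_def quotient_def)
  have "(SOME H. H \<in> C) \<in> C"
    using assms(2) by (rule someI)
  then have "((SOME H. H \<in> C), H) \<in> iso_rel"
    using quotient_eq_iff[OF equiv_iso_rel C C] assms(2) by blast
  then show ?thesis
    unfolding iso_density_def using assms(3)
    by (intro hom_density_isomorphic) (auto simp: iso_rel_def \<W>_def)
qed

end

theory Submission
  imports Defs
begin

text \<open>On a step function with \<open>p\<close> steps, \<open>t(H, -)\<close> is \<open>p\<close> to the power \<open>-|V(H)|\<close> times the sum, over
  all maps \<open>V(H) \<rightarrow> {1..p}\<close> that are injective on edges, of the monomial in the step values given
  by the image of the edge multiset. In a nontrivial vanishing combination choose \<open>H\<close> with the most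
  vertices among the graphs that occur, and \<open>p \<ge> |V(H)|\<close>. The monomial of an injective map of
  \<open>V(H)\<close> covers \<open>|V(H)|\<close> indices, so it comes only from injective maps, hence only from graphs
  isomorphic to \<open>H\<close>, and it does not cancel. Distinct monomials are linearly independent, being
  distinct multiplicative characters.\<close>

section \<open>Linear independence of multiplicative characters and of monomials\<close>

text \<open>Dedekind's argument, by induction on the number of characters: a point \<open>y\<close>
  that separates two of them turns a vanishing relation into a shorter one in which the coefficient
  of the other is still visible.\<close>

lemma characters_linearly_independent:
  fixes \<kappa> :: "'i \<Rightarrow> 'm \<Rightarrow> 'a::idom"
  assumes "finite I"
    and "\<And>x y. x \<in> X \<Longrightarrow> y \<in> X \<Longrightarrow> mul x y \<in> X"
    and "\<And>i x y. i \<in> I \<Longrightarrow> x \<in> X \<Longrightarrow> y \<in> X \<Longrightarrow> \<kappa> i (mul x y) = \<kappa> i x * \<kappa> i y"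
    and "\<And>i. i \<in> I \<Longrightarrow> \<exists>x\<in>X. \<kappa> i x \<noteq> 0"
    and "\<And>i j. i \<in> I \<Longrightarrow> j \<in> I \<Longrightarrow> i \<noteq> j \<Longrightarrow> \<exists>x\<in>X. \<kappa> i x \<noteq> \<kappa> j x"
    and "\<And>x. x \<in> X \<Longrightarrow> (\<Sum>i\<in>I. a i * \<kappa> i x) = 0"
    and "i \<in> I"
  shows "a i = 0"
  using assms
proof (induction I arbitrary: a i rule: finite_induct)
  case empty
  then show ?case by simp
next
  case (insert j I)
  note closed = insert.prems(1) and mult = insert.prems(2) and nz = insert.prems(3)
    and dist = insert.prems(4) and zero = insert.prems(5)
  have I0: "a k = 0" if k: "k \<in> I" for k
  proof -
    have "k \<noteq> j" using k insert.hyps by auto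
    then obtain y where y: "y \<in> X" "\<kappa> k y \<noteq> \<kappa> j y"
      using dist[of k j] k by auto
    \<comment> \<open>Subtracting \<open>\<kappa> j y\<close> times the relation at \<open>x\<close>
      from the relation at \<open>mul y x\<close> cancels the term of \<open>j\<close>. What remains
      is a relation over \<open>I\<close> with new coefficients, hence the generalisation of
      \<open>a\<close> in the induction.\<close>
    have "a k * (\<kappa> k y - \<kappa> j y) = 0"
    proof (rule insert.IH[of "\<lambda>i. a i * (\<kappa> i y - \<kappa> j y)" k])
      fix x assume x: "x \<in> X"
      have "(\<Sum>i\<in>insert j I. a i * (\<kappa> i y * \<kappa> i x)) = 0"
        using zero[OF closed[OF y(1) x]] mult[OF _ y(1) x] by simp
      moreover have "\<kappa> j y * (\<Sum>i\<in>insert j I. a i * \<kappa> i x) = 0"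
        using zero[OF x] by simp
      ultimately have "(\<Sum>i\<in>insert j I. a i * (\<kappa> i y * \<kappa> i x) - \<kappa> j y * (a i * \<kappa> i x)) = 0"
        by (simp add: sum_subtractf sum_distrib_left)
      then show "(\<Sum>i\<in>I. a i * (\<kappa> i y - \<kappa> j y) * \<kappa> i x) = 0"
        using insert.hyps by (simp add: algebra_simps)
    qed (use closed mult nz dist k in auto)
    then show ?thesis using y by simp
  qed
  obtain x where x: "x \<in> X" "\<kappa> j x \<noteq> 0" using nz[of j] by auto
  have "a j * \<kappa> j x = 0"
    using zero[OF x(1)] insert.hyps I0 by simp
  then have "a j = 0" using x by simp
  with I0 insert.prems(6) show ?case by auto
qed

text \<open>Each monomial is a multiplicative character of the weights with values in [0,1] under
  pointwise multiplication. The test weights are confined to this range because only such weights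
  will be turned into elements of \<open>\<W>_steps\<close>.\<close>

lemma monomials_linearly_independent:
  fixes a :: "'b multiset \<Rightarrow> real"
  assumes fin: "finite M"
    and zero: "\<And>w. (\<And>e. 0 \<le> w e \<and> w e \<le> 1) \<Longrightarrow> (\<Sum>m\<in>M. a m * (\<Prod>e\<in>#m. w e)) = 0"
    and m: "m \<in> M"
  shows "a m = 0"
proof (rule characters_linearly_independent[where \<kappa> = "\<lambda>m w. \<Prod>e\<in>#m. w e"
      and X = "{w. \<forall>e. 0 \<le> w e \<and> w e \<le> 1}" and mul = "\<lambda>v w e. v e * w e", OF fin _ _ _ _ _ m])
  show "\<exists>x\<in>{w. \<forall>e. 0 \<le> w e \<and> w e \<le> 1}. (\<Prod>e\<in>#k. x e) \<noteq> (0::real)" for k :: "'b multiset"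
    by (rule bexI[of _ "\<lambda>_. 1"]) auto
next
  fix k l :: "'b multiset" assume "k \<noteq> l"
  then obtain e where e: "count k e \<noteq> count l e"
    by (metis multiset_eqI)
  \<comment> \<open>Lowering the weight of the single element \<open>e\<close> to 1/2 evaluates a
    monomial to a power of 1/2 whose exponent is the multiplicity of \<open>e\<close>. This
    separates two multisets that differ there.\<close>
  have *: "(\<Prod>d\<in>#n. if d = e then 1/2 else 1) = (1/2 :: real) ^ count n e" for n
    by (induction n) auto
  show "\<exists>x\<in>{w. \<forall>e. 0 \<le> w e \<and> w e \<le> 1}. (\<Prod>e\<in>#k. x e) \<noteq> (\<Prod>e\<in>#l. x e :: real)"
    using e by (intro bexI[of _ "\<lambda>d. if d = e then 1/2 else 1"]) (auto simp: * power_inject_exp')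
qed (use zero in \<open>auto simp: prod_mset.distrib mult_le_one\<close>)


section \<open>Step functions\<close>

text \<open>The default 0 covers two situations: the absent diagonal blocks, where the two indices
  coincide and \<open>s\<close> is a singleton, and points whose index lies outside
  \<open>{1..p}\<close>. Taking a set as argument builds in the symmetry.\<close>

definition edge_weight :: "nat \<Rightarrow> (nat set \<Rightarrow> real) \<Rightarrow> nat set \<Rightarrow> real" where
  "edge_weight p w s = (if s \<subseteq> {1..p} \<and> card s = 2 then w s else 0)"

definition step_fun :: "nat \<Rightarrow> (nat set \<Rightarrow> real) \<Rightarrow> real \<times> real \<Rightarrow> real" where
  "step_fun p w z = (\<Sum>(a, b) \<in> block_pairs p. w {a, b} * block p a b z)"

text \<open>The ceiling fits intervals that are open on the left and closed on the right. Points
  \<open>x \<le> 0\<close> receive index 0, which no block uses.\<close>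

definition step_index :: "nat \<Rightarrow> real \<Rightarrow> nat" where
  "step_index p x = nat \<lceil>real p * x\<rceil>"

lemma step_index_eq_iff:
  assumes "p \<ge> 1" "a \<ge> 1"
  shows "x \<in> {(real a - 1) / real p <.. real a / real p} \<longleftrightarrow> step_index p x = a"
proof -
  have "step_index p x = a \<longleftrightarrow> \<lceil>real p * x\<rceil> = int a"
    unfolding step_index_def using assms by auto
  also have "\<dots> \<longleftrightarrow> real a - 1 < real p * x \<and> real p * x \<le> real a"
    by (simp add: ceiling_eq_iff)
  finally show ?thesis using assms by (auto simp: field_simps)
qed

text \<open>Read contrapositively, this yields the vanishing outside the unit square that is
  demanded of representatives in \<W>.\<close>

lemma step_index_range:
  assumes "p \<ge> 1" "step_index p x \<in> {1..p}"
  shows "x \<in> {0..1}"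
proof -
  have "1 \<le> nat \<lceil>real p * x\<rceil>" "nat \<lceil>real p * x\<rceil> \<le> p"
    using assms(2) by (simp_all add: step_index_def)
  then have "0 < \<lceil>real p * x\<rceil>" "\<lceil>real p * x\<rceil> \<le> int p"
    by linarith+
  then have "0 < real p * x" "real p * x \<le> real p"
    by (simp_all add: ceiling_le_iff)
  then show ?thesis using assms(1) by (auto simp: zero_less_mult_iff)
qed

lemma step_fun_eq:
  assumes p: "p \<ge> 1"
  shows "step_fun p w (x, y) = edge_weight p w {step_index p x, step_index p y}"
proof -
  define i j where ij: "i = step_index p x" "j = step_index p y"
  \<comment> \<open>At most one block can contain \<open>(x, y)\<close>, the one of the sorted index
    pair, so the sum has at most one nonzero term.\<close>
  have "step_fun p w (x, y) = (\<Sum>z \<in> block_pairs p. if z = (min i j, max i j) then w {fst z, snd z} else 0)"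
    unfolding step_fun_def
  proof (rule sum.cong[OF refl], clarify)
    fix a b assume "(a, b) \<in> block_pairs p"
    then have ab: "1 \<le> a" "1 \<le> b" "a < b" by (auto simp: block_pairs_def)
    have "block p a b (x, y) = of_bool (i = a \<and> j = b) + of_bool (i = b \<and> j = a)"
      using step_index_eq_iff[OF p ab(1)] step_index_eq_iff[OF p ab(2)]
      by (auto simp: block_def cell_def ij indicator_def)
    also have "\<dots> = of_bool ((a, b) = (min i j, max i j))"
      using ab by (auto simp: min_def max_def)
    finally show "w {a, b} * block p a b (x, y) = (if (a, b) = (min i j, max i j) then w {fst (a, b), snd (a, b)} else 0)"
      by simp
  qed
  also have "\<dots> = (if (min i j, max i j) \<in> block_pairs p then w {min i j, max i j} else 0)"
  proof -
    have "finite (block_pairs p)"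
      by (rule finite_subset[of _ "{..p} \<times> {..p}"]) (auto simp: block_pairs_def)
    then show ?thesis
      by (simp add: sum.delta)
  qed
  \<comment> \<open>For \<open>i = j\<close> both sides are 0: the pair is not strictly increasing
    and the set is a singleton.\<close>
  also have "\<dots> = edge_weight p w {i, j}"
    by (auto simp: block_pairs_def edge_weight_def min_def max_def insert_commute card_insert_if)
  finally show ?thesis by (simp add: ij)
qed

lemma step_fun_measurable [measurable]: "step_fun p w \<in> borel_measurable borel"
proof -
  have [measurable]: "cell p a b \<in> sets borel" for a b
    unfolding cell_def borel_prod[symmetric] by measurable
  show ?thesis
    unfolding step_fun_def block_def case_prod_unfold by measurable
qed

lemma step_fun_in_steps:
  assumes p: "p \<ge> 1" and w: "\<And>e. 0 \<le> w e \<and> w e \<le> 1"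
  shows "step_fun p w \<in> \<W>_steps"
proof -
  have range: "0 \<le> step_fun p w z \<and> step_fun p w z \<le> 1" for z
    using w by (cases z) (auto simp: step_fun_eq[OF p] edge_weight_def)
  have "step_fun p w z = 0" if "z \<notin> unit_square" for z
    using that step_index_range[OF p]
    by (cases z) (auto simp: step_fun_eq[OF p] edge_weight_def unit_square_def)
  moreover have "step_fun p w \<in> borel_measurable (lebesgue_on unit_square)"
    by (intro measurable_restrict_space1 measurable_completion) simp
  moreover have "bounded (step_fun p w ` unit_square)"
    using range by (intro boundedI[of _ 1]) auto
  moreover have "step_fun p w (x, y) = step_fun p w (y, x)" for x y
    by (simp add: step_fun_eq[OF p] insert_commute)
  moreover have "step_fun p w \<in> block_span p"
    unfolding block_span_def step_fun_def by (auto intro!: exI[of _ "\<lambda>a b. w {a, b}"])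
  ultimately have "step_fun p w \<in> \<W>_step p"
    using range by (auto simp: \<W>_step_def \<W>_unit_def \<W>_def)
  then show ?thesis using p by (auto simp: \<W>_steps_def)
qed


section \<open>Densities of step functions\<close>

text \<open>For a multigraph these are the proper colourings with colours \<open>{1..p}\<close>,
  that is, the homomorphisms to the complete graph on \<open>{1..p}\<close>. Extensionality ensures
  that each is counted once.\<close>

definition edge_maps :: "nat \<Rightarrow> multigraph \<Rightarrow> (nat \<Rightarrow> nat) set" where
  "edge_maps p H = {\<phi> \<in> verts H \<rightarrow>\<^sub>E {1..p}. \<forall>e \<in># edges H. card (\<phi> ` e) = 2}"

lemma finite_edge_maps: "multigraph H \<Longrightarrow> finite (edge_maps p H)"
  by (auto simp: edge_maps_def multigraph_def intro!: finite_PiE)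

text \<open>An edge whose endpoints receive the same index contributes a factor 0, which kills the
  whole product.\<close>

lemma prod_edge_weight:
  assumes H: "multigraph H" and \<phi>: "\<phi> \<in> verts H \<rightarrow>\<^sub>E {1..p}"
  shows "(\<Prod>e\<in>#edges H. edge_weight p w (\<phi> ` e)) =
    (if \<phi> \<in> edge_maps p H then \<Prod>e\<in>#image_mset (image \<phi>) (edges H). w e else 0)"
proof -
  have sub: "\<phi> ` e \<subseteq> {1..p}" if "e \<in># edges H" for e
    using that H \<phi> by (fastforce simp: multigraph_def PiE_def Pi_def)
  show ?thesis
  proof (cases "\<phi> \<in> edge_maps p H")
    case True
    then show ?thesis using sub
      by (auto simp: multiset.map_comp comp_def edge_maps_def edge_weight_def
          intro!: arg_cong[of _ _ prod_mset] image_mset_cong)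
  next
    case False
    then obtain e where "e \<in># edges H" "card (\<phi> ` e) \<noteq> 2"
      using \<phi> by (auto simp: edge_maps_def)
    then have "0 \<in># image_mset (\<lambda>e. edge_weight p w (\<phi> ` e)) (edges H)"
      by (force simp: edge_weight_def)
    then show ?thesis using False by (simp add: prod_mset_zero_iff)
  qed
qed

text \<open>Boxes of different maps are disjoint, so at a given \<open>x\<close> only the map
  \<open>\<psi>\<close> that sends each vertex to the index of its coordinate can contribute. This
  turns the integrand into a finite combination of box indicators.\<close>

lemma prod_step_fun:
  assumes p: "p \<ge> 1" and H: "multigraph H" "no_isolated_verts H" and x: "x \<in> extensional (verts H)"
  shows "(\<Prod>e\<in>#edges H. step_fun p w (x (Min e), x (Max e))) =
    (\<Sum>\<phi>\<in>verts H \<rightarrow>\<^sub>E {1..p}. (\<Prod>e\<in>#edges H. edge_weight p w (\<phi> ` e)) *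
       indicator (\<Pi>\<^sub>E v\<in>verts H. {(real (\<phi> v) - 1) / real p <.. real (\<phi> v) / real p}) x)"
    (is "?g = (\<Sum>\<phi>\<in>?A. ?G \<phi> * indicator (?B \<phi>) x)")
proof -
  define \<psi> where "\<psi> = (\<lambda>v\<in>verts H. step_index p (x v))"
  have g: "?g = ?G \<psi>"
  proof (intro arg_cong[of _ _ prod_mset] image_mset_cong)
    fix e assume "e \<in># edges H"
    then have e: "e \<subseteq> verts H" "card e = 2" using H by (auto simp: multigraph_def)
    from e(2) obtain u v where "e = {u, v}"
      by (auto simp: card_2_iff)
    then show "step_fun p w (x (Min e), x (Max e)) = edge_weight p w (\<psi> ` e)"
      using e by (simp add: step_fun_eq[OF p] \<psi>_def max_def min_def insert_commute)
  qed
  have ind: "x \<in> ?B \<phi> \<longleftrightarrow> \<phi> = \<psi>" if \<phi>: "\<phi> \<in> ?A" for \<phi>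
  proof -
    have ge: "v \<in> verts H \<Longrightarrow> \<phi> v \<ge> 1" for v using \<phi> by (auto simp: PiE_def Pi_def)
    have "x \<in> ?B \<phi> \<longleftrightarrow> (\<forall>v\<in>verts H. step_index p (x v) = \<phi> v)"
      using x step_index_eq_iff[OF p ge] unfolding PiE_def Pi_def by blast
    also have "\<dots> \<longleftrightarrow> \<phi> = \<psi>"
      using \<phi> unfolding \<psi>_def PiE_def extensional_def by (auto simp: fun_eq_iff)
    finally show ?thesis .
  qed
  have "(\<Sum>\<phi>\<in>?A. ?G \<phi> * indicator (?B \<phi>) x) = (\<Sum>\<phi>\<in>?A. if \<phi> = \<psi> then ?G \<psi> else 0)"
    by (intro sum.cong) (auto simp: ind simp del: PiE_iff)
  also have "\<dots> = (if \<psi> \<in> ?A then ?G \<psi> else 0)"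
    using H by (simp add: multigraph_def finite_PiE)
  also have "\<dots> = ?G \<psi>"
  proof (cases "\<psi> \<in> ?A")
    \<comment> \<open>A vertex with an index outside \<open>{1..p}\<close> lies on some edge, since
      no vertex is isolated, and the weight of that edge is 0. So the product vanishes, as the empty
      selection of boxes requires.\<close>
    case False
    then have "\<not> (\<forall>v\<in>verts H. \<psi> v \<in> {1..p})"
      unfolding \<psi>_def by auto
    then obtain v where v: "v \<in> verts H" "\<psi> v \<notin> {1..p}"
      by blast
    then obtain e where "e \<in># edges H" "v \<in> e"
      using H by (auto simp: no_isolated_verts_def)
    then have "0 \<in># image_mset (\<lambda>e. edge_weight p w (\<psi> ` e)) (edges H)"
      using v by (force simp: edge_weight_def)
    then show ?thesis using False by (simp add: prod_mset_zero_iff)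
  qed simp
  finally show ?thesis using g by simp
qed

lemma hom_density_step_fun:
  assumes p: "p \<ge> 1" and H: "multigraph H" "no_isolated_verts H"
  shows "hom_density H (step_fun p w) =
    (\<Sum>\<phi>\<in>edge_maps p H. \<Prod>e\<in>#image_mset (image \<phi>) (edges H). w e) / real p ^ card (verts H)"
proof -
  let ?U = "restrict_space lborel {0..1::real}"
  let ?P = "\<Pi>\<^sub>M v \<in> verts H. ?U"
  let ?A = "verts H \<rightarrow>\<^sub>E {1..p}"
  let ?G = "\<lambda>\<phi>. \<Prod>e\<in>#edges H. edge_weight p w (\<phi> ` e)"
  let ?c = "\<lambda>a. {(real a - 1) / real p <.. real a / real p}"
  have fV: "finite (verts H)" using H by (simp add: multigraph_def)
  have U: "prob_space ?U"
    by (rule prob_spaceI) (simp add: space_restrict_space emeasure_restrict_space)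
  interpret U: prob_space ?U by (rule U)
  interpret finite_product_prob_space "\<lambda>_. ?U" "verts H"
    by unfold_locales (rule fV)
  have c: "?c a \<in> sets ?U" "measure ?U (?c a) = 1 / real p" if "a \<in> {1..p}" for a
  proof -
    have "?c a \<subseteq> {0..1}"
      using step_index_eq_iff[OF p, of a] step_index_range[OF p] that by auto
    then show "?c a \<in> sets ?U" "measure ?U (?c a) = 1 / real p"
      using p by (auto simp: sets_restrict_space_iff measure_restrict_space divide_right_mono diff_divide_distrib)
  qed
  have box: "Pi\<^sub>E (verts H) (\<lambda>v. ?c (\<phi> v)) \<in> sets ?P"
       "measure ?P (Pi\<^sub>E (verts H) (\<lambda>v. ?c (\<phi> v))) = 1 / real p ^ card (verts H)"
    if \<phi>: "\<phi> \<in> ?A" for \<phi>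
  proof -
    have \<phi>v: "\<phi> v \<in> {1..p}" if "v \<in> verts H" for v using \<phi> that by auto
    show "Pi\<^sub>E (verts H) (\<lambda>v. ?c (\<phi> v)) \<in> sets ?P"
      using c(1)[OF \<phi>v] fV by (intro sets_PiM_I_finite) auto
    have "measure ?P (Pi\<^sub>E (verts H) (\<lambda>v. ?c (\<phi> v))) = (\<Prod>v\<in>verts H. measure ?U (?c (\<phi> v)))"
      using c(1)[OF \<phi>v] by (intro prob_times) auto
    also have "\<dots> = 1 / real p ^ card (verts H)"
      using c(2)[OF \<phi>v] by (simp add: power_one_over)
    finally show "measure ?P (Pi\<^sub>E (verts H) (\<lambda>v. ?c (\<phi> v))) = 1 / real p ^ card (verts H)" .
  qed
  let ?s = "\<lambda>x. \<Sum>\<phi>\<in>?A. ?G \<phi> * indicator (\<Pi>\<^sub>E v\<in>verts H. ?c (\<phi> v)) x"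
  have "hom_density H (step_fun p w) = (LINT x | completion ?P. ?s x)"
    unfolding hom_density_def
    by (intro Bochner_Integration.integral_cong refl prod_step_fun[OF p H])
       (auto simp: space_PiM PiE_def)
  \<comment> \<open>Box indicators are measurable already for the product measure itself, so passing
    to the completion does not change the integral.\<close>
  also have "\<dots> = (LINT x | ?P. ?s x)"
    using box(1) by (intro integral_completion borel_measurable_sum borel_measurable_times) auto
  also have "\<dots> = (\<Sum>\<phi>\<in>?A. LINT x | ?P. ?G \<phi> * indicator (\<Pi>\<^sub>E v\<in>verts H. ?c (\<phi> v)) x)"
    using box(1) by (intro Bochner_Integration.integral_sum) 
      (auto intro!: integrable_mult_right integrable_real_indicator simp: emeasure_eq_measure)
  also have "\<dots> = (\<Sum>\<phi>\<in>?A. ?G \<phi> / real p ^ card (verts H))"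
    using box sets.sets_into_space[OF box(1)] by (intro sum.cong) (auto simp: Int_absorb2)
  also have "\<dots> = (\<Sum>\<phi>\<in>?A. ?G \<phi>) / real p ^ card (verts H)"
    by (simp add: sum_divide_distrib)
  also have "(\<Sum>\<phi>\<in>?A. ?G \<phi>) =
      (\<Sum>\<phi>\<in>?A. if \<phi> \<in> edge_maps p H then \<Prod>e\<in>#image_mset (image \<phi>) (edges H). w e else 0)"
    by (intro sum.cong refl prod_edge_weight[OF H(1)])
  also have "\<dots> = (\<Sum>\<phi>\<in>edge_maps p H. \<Prod>e\<in>#image_mset (image \<phi>) (edges H). w e)"
    using fV by (subst sum.inter_filter[symmetric])
      (auto intro!: finite_PiE sum.cong simp: edge_maps_def)
  finally show ?thesis .
qed


section \<open>Linear independence\<close>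

text \<open>Since every vertex lies on an edge, the set of indices that a map covers can be read off
  from its monomial alone.\<close>

lemma image_verts_eq_Union_edges:
  assumes "multigraph H" "no_isolated_verts H"
  shows "\<phi> ` verts H = \<Union> (set_mset (image_mset (image \<phi>) (edges H)))"
  using assms by (fastforce simp: multigraph_def no_isolated_verts_def)

text \<open>Equal monomials cover the same indices, so \<open>\<phi>\<close> has an image of size
  |V(H)|. As this is at least |V(G)|, \<open>\<phi>\<close> cannot identify vertices, and
  \<open>\<phi>\<close> followed by the inverse of \<open>\<psi>\<close> is an isomorphism.\<close>

lemma isomorphic_if_same_image:
  assumes G: "multigraph G" "no_isolated_verts G" and H: "multigraph H" "no_isolated_verts H"
    and inj: "inj_on \<psi> (verts H)" and le: "card (verts G) \<le> card (verts H)"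
    and eq: "image_mset (image \<phi>) (edges G) = image_mset (image \<psi>) (edges H)"
  shows "isomorphic G H"
proof -
  let ?\<rho> = "inv_into (verts H) \<psi>"
  have im: "\<phi> ` verts G = \<psi> ` verts H"
    using image_verts_eq_Union_edges[OF G, of \<phi>] image_verts_eq_Union_edges[OF H, of \<psi>] eq by simp
  have "card (\<phi> ` verts G) = card (verts G)"
    using im card_image[OF inj] le card_image_le[of "verts G" \<phi>] G by (simp add: multigraph_def)
  then have "bij_betw \<phi> (verts G) (\<psi> ` verts H)"
    using im G by (simp add: bij_betw_def multigraph_def eq_card_imp_inj_on)
  moreover have "bij_betw ?\<rho> (\<psi> ` verts H) (verts H)"
    using inj by (simp add: bij_betw_inv_into inj_on_imp_bij_betw)
  ultimately have "bij_betw (?\<rho> \<circ> \<phi>) (verts G) (verts H)"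
    by (rule bij_betw_trans)
  moreover have "image_mset (image (?\<rho> \<circ> \<phi>)) (edges G) = image_mset (image ?\<rho>) (image_mset (image \<phi>) (edges G))"
    by (simp add: multiset.map_comp comp_def image_image)
  moreover have "\<dots> = edges H"
  proof -
    have "?\<rho> ` \<psi> ` e = e" if "e \<in># edges H" for e
      using that H inj by (auto simp: multigraph_def inv_into_image_cancel)
    then have "image_mset (\<lambda>e. ?\<rho> ` \<psi> ` e) (edges H) = image_mset (\<lambda>e. e) (edges H)"
      by (intro image_mset_cong)
    then show ?thesis
      by (simp add: eq multiset.map_comp comp_def)
  qed
  ultimately show ?thesis
    unfolding isomorphic_def by (auto intro!: exI[of _ "?\<rho> \<circ> \<phi>"])
qed

lemma \<H>_representative:
  assumes "C \<in> \<H>"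
  obtains H where "multigraph H" "no_isolated_verts H" "C = iso_rel `` {H}" "H \<in> C"
proof -
  obtain H where H: "multigraph H" "no_isolated_verts H" "C = iso_rel `` {H}"
    using assms by (auto simp: \<H>_def quotient_def)
  moreover have "H \<in> C"
    using H equiv_class_self[OF equiv_iso_rel] by auto
  ultimately show thesis by (rule that)
qed

lemma linearly_independent_steps: "linearly_independent_on \<H> iso_density \<W>_steps"
  unfolding linearly_independent_on_def
proof (intro allI impI, elim conjE)
  fix F and c :: "multigraph set \<Rightarrow> real"
  assume F: "finite F" "F \<subseteq> \<H>" and zero: "\<forall>f\<in>\<W>_steps. (\<Sum>C\<in>F. c C * iso_density C f) = 0"
  have "\<forall>C\<in>F. \<exists>H. multigraph H \<and> no_isolated_verts H \<and> C = iso_rel `` {H} \<and> H \<in> C"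
    using F(2) \<H>_representative by (metis subsetD)
  then obtain r where r: "\<And>C. C \<in> F \<Longrightarrow> multigraph (r C)" "\<And>C. C \<in> F \<Longrightarrow> no_isolated_verts (r C)"
      "\<And>C. C \<in> F \<Longrightarrow> C = iso_rel `` {r C}" "\<And>C. C \<in> F \<Longrightarrow> r C \<in> C"
    by metis
  have eqI: "C = D" if "C \<in> F" "D \<in> F" "isomorphic (r C) (r D)" for C D
    using that r equiv_class_eq[OF equiv_iso_rel, of "r C" "r D"] by (auto simp: iso_rel_def)
  show "\<forall>C\<in>F. c C = 0"
  proof (rule ccontr)
    assume nz: "\<not> (\<forall>C\<in>F. c C = 0)"
    let ?S = "(\<lambda>C. card (verts (r C))) ` {C\<in>F. c C \<noteq> 0}"
    have S: "finite ?S" "?S \<noteq> {}"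
      using F nz by auto
    obtain D where "Max ?S = card (verts (r D))" "D \<in> {C\<in>F. c C \<noteq> 0}"
      using Max_in[OF S] by (rule imageE)
    then have D: "D \<in> F" "c D \<noteq> 0" "card (verts (r D)) = Max ?S"
      by auto
    have max: "card (verts (r C)) \<le> card (verts (r D))" if "C \<in> F" "c C \<noteq> 0" for C
      unfolding D(3) using that by (intro Max_ge[OF S(1)]) auto
    \<comment> \<open>This leaves room for an injective map of the vertices of \<open>r D\<close>,
      and \<open>Suc\<close> keeps \<open>p\<close> positive even when there are none.\<close>
    define p where "p = Suc (card (verts (r D)))"
    then have p: "p \<ge> 1" by simp
    define mon where "mon = (\<lambda>C \<phi>. image_mset (image \<phi>) (edges (r C)) :: nat set multiset)"
    define M where "M = (\<Union>C\<in>F. mon C ` edge_maps p (r C))"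
    \<comment> \<open>\<open>a m\<close> is the coefficient of the monomial \<open>m\<close> in the
      expanded combination: every map producing \<open>m\<close> counts once, scaled by the volume
      of its box.\<close>
    define a where "a = (\<lambda>m. \<Sum>C\<in>F. c C / real p ^ card (verts (r C)) *
      real (card {\<phi> \<in> edge_maps p (r C). mon C \<phi> = m}))"
    have fM: "finite M" unfolding M_def using F r finite_edge_maps by auto
    have a0: "a m = 0" if "m \<in> M" for m
    proof (rule monomials_linearly_independent[OF fM _ that])
      fix w :: "nat set \<Rightarrow> real" assume w: "\<And>e. 0 \<le> w e \<and> w e \<le> 1"
      let ?f = "step_fun p w"
      have f: "?f \<in> \<W>_steps" by (rule step_fun_in_steps[OF p w])
      then have fW: "?f \<in> \<W>" by (auto simp: \<W>_steps_def \<W>_step_def \<W>_unit_def)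
      have "0 = (\<Sum>C\<in>F. c C * iso_density C ?f)" using zero f by simp
      also have "\<dots> = (\<Sum>C\<in>F. \<Sum>m\<in>M. c C / real p ^ card (verts (r C)) *
          real (card {\<phi> \<in> edge_maps p (r C). mon C \<phi> = m}) * (\<Prod>e\<in>#m. w e))"
      proof (rule sum.cong[OF refl])
        fix C assume C: "C \<in> F"
        have "iso_density C ?f = hom_density (r C) ?f"
          using C F r by (intro iso_density_eq[OF _ _ fW]) auto
        also have "\<dots> = (\<Sum>\<phi>\<in>edge_maps p (r C). \<Prod>e\<in>#mon C \<phi>. w e) / real p ^ card (verts (r C))"
          using C r unfolding mon_def by (intro hom_density_step_fun[OF p]) auto
        \<comment> \<open>The maps are grouped by the monomial that they produce.\<close>
        also have "(\<Sum>\<phi>\<in>edge_maps p (r C). \<Prod>e\<in>#mon C \<phi>. w e) =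
            (\<Sum>m\<in>M. \<Sum>\<phi>\<in>{\<phi> \<in> edge_maps p (r C). mon C \<phi> = m}. \<Prod>e\<in>#mon C \<phi>. w e)"
          using C r finite_edge_maps fM by (intro sum.group[symmetric]) (auto simp: M_def)
        also have "\<dots> = (\<Sum>m\<in>M. real (card {\<phi> \<in> edge_maps p (r C). mon C \<phi> = m}) * (\<Prod>e\<in>#m. w e))"
          by simp
        finally show "c C * iso_density C ?f = (\<Sum>m\<in>M. c C / real p ^ card (verts (r C)) *
            real (card {\<phi> \<in> edge_maps p (r C). mon C \<phi> = m}) * (\<Prod>e\<in>#m. w e))"
          by (simp add: sum_distrib_left sum_divide_distrib mult.assoc)
      qed
      also have "\<dots> = (\<Sum>m\<in>M. a m * (\<Prod>e\<in>#m. w e))"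
        unfolding a_def sum_distrib_right by (rule sum.swap)
      finally show "(\<Sum>m\<in>M. a m * (\<Prod>e\<in>#m. w e)) = 0" by simp
    qed
    have "finite (verts (r D))" using r(1)[OF D(1)] by (simp add: multigraph_def)
    then obtain \<psi>0 where \<psi>0: "\<psi>0 ` verts (r D) \<subseteq> {1..p}" "inj_on \<psi>0 (verts (r D))"
      using card_le_inj[of "verts (r D)" "{1..p}"] by (auto simp: p_def)
    define \<psi> where "\<psi> = restrict \<psi>0 (verts (r D))"
    have inj: "inj_on \<psi> (verts (r D))" using \<psi>0 by (simp add: \<psi>_def)
    have "card (\<psi> ` e) = 2" if "e \<in># edges (r D)" for e
      using that r(1)[OF D(1)] inj by (auto simp: multigraph_def card_image inj_on_subset)
    then have \<psi>: "\<psi> \<in> edge_maps p (r D)"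
      using \<psi>0 by (auto simp: edge_maps_def \<psi>_def)
    let ?m = "mon D \<psi>"
    have "a ?m = (\<Sum>C\<in>F. if C = D then c D / real p ^ card (verts (r D)) *
      real (card {\<phi> \<in> edge_maps p (r D). mon D \<phi> = ?m}) else 0)"
      unfolding a_def
    proof (rule sum.cong[OF refl])
      fix C assume C: "C \<in> F"
      \<comment> \<open>If \<open>c C\<close> is nonzero, \<open>r C\<close> has at most as many
        vertices as \<open>r D\<close>. A map of it producing \<open>?m\<close> would then make the
        two graphs isomorphic and hence the classes equal.\<close>
      have "c C = 0 \<or> {\<phi> \<in> edge_maps p (r C). mon C \<phi> = ?m} = {}" if "C \<noteq> D"
        using isomorphic_if_same_image[of "r C" "r D" \<psi>] r C D inj max[OF C] eqI[OF C D(1)] that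
        unfolding mon_def by blast
      then have "c C = 0 \<or> card {\<phi> \<in> edge_maps p (r C). mon C \<phi> = ?m} = 0" if "C \<noteq> D"
        using that by (metis card.empty)
      then show "c C / real p ^ card (verts (r C)) * real (card {\<phi> \<in> edge_maps p (r C). mon C \<phi> = ?m}) =
        (if C = D then c D / real p ^ card (verts (r D)) *
          real (card {\<phi> \<in> edge_maps p (r D). mon D \<phi> = ?m}) else 0)"
        by (cases "C = D") auto
    qed
    also have "\<dots> = c D / real p ^ card (verts (r D)) * real (card {\<phi> \<in> edge_maps p (r D). mon D \<phi> = ?m})"
      using F D by simp
    \<comment> \<open>The map \<open>\<psi>\<close> is itself among those counted, and the count
      only multiplies \<open>c D\<close>, so nothing can cancel.\<close>
    also have "\<dots> \<noteq> 0"
    proof -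
      have "finite {\<phi> \<in> edge_maps p (r D). mon D \<phi> = ?m}"
        using finite_edge_maps[OF r(1)[OF D(1)]] by simp
      then have "card {\<phi> \<in> edge_maps p (r D). mon D \<phi> = ?m} \<noteq> 0"
        using \<psi> by auto
      then show ?thesis using D p by simp
    qed
    finally show False
      using a0[of ?m] \<psi> D by (auto simp: M_def)
  qed
qed

lemma linearly_independent_on_mono:
  assumes "linearly_independent_on I \<phi> X" "J \<subseteq> I" "X \<subseteq> Y"
  shows "linearly_independent_on J \<phi> Y"
  using assms unfolding linearly_independent_on_def by (meson subset_iff)

theorem corollary3p24:
  shows "linearly_independent_on \<H> iso_density \<W>_steps
       \<and> linearly_independent_on \<H> iso_density \<W>
       \<and> linearly_independent_on \<G> iso_density \<W>_steps
       \<and> linearly_independent_on \<G> iso_density \<W>"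
proof -
  \<comment> \<open>Both quotients use the same relation on all multigraphs, so the class of a
    simple graph is literally the same set in \<G> and in \<H>.\<close>
  have "\<G> \<subseteq> \<H>"
    by (auto simp: \<G>_def \<H>_def quotient_def simple_graph_def)
  moreover have "\<W>_steps \<subseteq> \<W>"
    by (auto simp: \<W>_steps_def \<W>_step_def \<W>_unit_def)
  ultimately show ?thesis
    using linearly_independent_on_mono[OF linearly_independent_steps] by blast
qed

end
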